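(* Let $(X,\kappa)$ and $(Y,\lambda)$ be digital images. If $X\simeq Y$ then $X\simeq^{\mathbb R}Y$. If $x_0\in X$, $y_0\in Y$ and $(X,x_0)\simeq(Y,y_0)$, then $(X,x_0)\simeq^{\mathbb R}(Y,y_0)$. If both $X$ and $Y$ are finite, then the converses hold.
   Context: A digital image $(X,\kappa)$ is a set $X\subset\mathbb Z^n$ (for some $n\ge 1$) with an adjacency relation $\kappa$ (a symmetric, irreflexive relation). A subset is $\kappa$-connected if any two distinct points of it are joined by a finite sequence of points of the subset whose consecutive members are $\kappa$-adjacent. A function $f:(X,\kappa)\to(Y,\lambda)$ is $(\kappa,\lambda)$-continuous if it maps $\kappa$-connected sets to $\lambda$-connected sets; equivalently, $\kappa$-adjacent points are mapped to equal or $\lambda$-adjacent points. $[a,b]_{\mathbb Z}=\{z\in\mathbb Z: a\le z\le b\}$; subsets of $\mathbb Z$ carry the adjacency in which consecutive integers are adjacent. Homotopy: continuous $f,g:X\to Y$ are homotopic in $Y$, $f\simeq g$, if there are a positive integer $m$ and $F:X\times[0,m]_{\mathbb Z}\to Y$ with $F(x,0)=f(x)$, $F(x,m)=g(x)$ for all $x$, such that $t\mapsto F(x,t)$ is continuous for each $x\in X$ and $x\mapsto F(x,t)$ is $(\kappa,\lambda)$-continuous for each $t$. $F$ holds $x$ fixed if $F(x,t)=F(x,0)$ for all $t$. $X\simeq Y$ (same homotopy type) if there are continuous $f:X\to Y$, $g:Y\to X$ with $g\circ f\simeq1_X$, $f\circ g\simeq1_Y$; $(X,x_0)\simeq(Y,y_0)$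 if moreover $f(x_0)=y_0$, $g(y_0)=x_0$ and the homotopies can be chosen to hold $x_0$, respectively $y_0$, fixed. Real homotopy: $f:[0,1]\to (Y,\lambda)$ ($[0,1]\subset\mathbb R$) is a real $\lambda$-path if (i) there is $\epsilon_0>0$ such that $f$ is constant on $(0,\epsilon_0)$ with value equal or $\lambda$-adjacent to $f(0)$; (ii) there is $\epsilon_1>0$ such that $f$ is constant on $(1-\epsilon_1,1)$ with value equal or $\lambda$-adjacent to $f(1)$; (iii) for each $t\in(0,1)$ there is $\epsilon_t>0$ such that $f$ is constant on each of $(t-\epsilon_t,t)$ and $(t,t+\epsilon_t)$, these two values are equal or $\lambda$-adjacent, and at least one of them equals $f(t)$. A real homotopy from $f$ to $g$ (continuous $X\to Y$), $f\simeq^{\mathbb R}g$, is $F:X\times[0,1]\to Y$ with $F(x,0)=f(x)$, $F(x,1)=g(x)$, such that $t\mapsto F(x,t)$ is a real $\lambda$-path in $Y$ for each $x$ and $x\mapsto F(x,t)$ is $(\kappa,\lambda)$-continuous for each $t$. $X\simeq^{\mathbb R}Y$ (same real homotopy type) if there are continuous $f:X\to Y$, $g:Y\to X$ with $g\circ f\simeq^{\mathbb R}1_X$, $f\circ g\simeq^{\mathbb R}1_Y$; $(X,x_0)\simeq^{\mathbb R}(Y,y_0)$ if moreover $f(x_0)=y_0$, $g(y_0)=x_0$ and these real homotopies are constantly $x_0$ at $x_0$, respectively constantly $y_0$ at $y_0$. *)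

theory Defs
  imports "HOL-Analysis.Analysis"
begin

text \<open>
  Functions between digital images are total HOL functions; only their values on the
  carrier sets matter. Continuity, connectedness and homotopy are stated over an arbitrary
  point type, so that the same notions apply to subsets of \<open>int ^ 'n\<close> and to integer
  intervals in the type \<open>int\<close>.
\<close>

definition digital_image :: "(int ^ 'n) set \<Rightarrow> (int ^ 'n \<Rightarrow> int ^ 'n \<Rightarrow> bool) \<Rightarrow> bool" where
  "digital_image X \<kappa> \<longleftrightarrow> symp_on X \<kappa> \<and> irreflp_on X \<kappa>"

definition adj_or_eq :: "('a \<Rightarrow> 'a \<Rightarrow> bool) \<Rightarrow> 'a \<Rightarrow> 'a \<Rightarrow> bool" where
  "adj_or_eq \<kappa> x y \<longleftrightarrow> x = y \<or> \<kappa> x y"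

definition int_adj :: "int \<Rightarrow> int \<Rightarrow> bool" where
  "int_adj s t \<longleftrightarrow> \<bar>s - t\<bar> = 1"

definition dig_connected :: "('a \<Rightarrow> 'a \<Rightarrow> bool) \<Rightarrow> 'a set \<Rightarrow> bool" where
  "dig_connected \<kappa> A \<longleftrightarrow>
     (\<forall>x\<in>A. \<forall>y\<in>A. x \<noteq> y \<longrightarrow>
        (\<exists>ps. ps \<noteq> [] \<and> hd ps = x \<and> last ps = y \<and> set ps \<subseteq> A \<and> successively \<kappa> ps))"

definition dig_continuous ::
    "'a set \<Rightarrow> ('a \<Rightarrow> 'a \<Rightarrow> bool) \<Rightarrow> 'b set \<Rightarrow> ('b \<Rightarrow> 'b \<Rightarrow> bool) \<Rightarrow> ('a \<Rightarrow> 'b) \<Rightarrow> bool" where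
  "dig_continuous X \<kappa> Y \<mu> f \<longleftrightarrow>
     f ` X \<subseteq> Y \<and> (\<forall>A\<subseteq>X. dig_connected \<kappa> A \<longrightarrow> dig_connected \<mu> (f ` A))"

definition dig_homotopy ::
    "'a set \<Rightarrow> ('a \<Rightarrow> 'a \<Rightarrow> bool) \<Rightarrow> 'b set \<Rightarrow> ('b \<Rightarrow> 'b \<Rightarrow> bool) \<Rightarrow> ('a \<Rightarrow> 'b) \<Rightarrow> ('a \<Rightarrow> 'b)
      \<Rightarrow> int \<Rightarrow> ('a \<Rightarrow> int \<Rightarrow> 'b) \<Rightarrow> bool" where
  "dig_homotopy X \<kappa> Y \<mu> f g m F \<longleftrightarrow>
     dig_continuous X \<kappa> Y \<mu> f \<and> dig_continuous X \<kappa> Y \<mu> g \<and>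
     0 < m \<and>
     (\<forall>x\<in>X. F x 0 = f x) \<and> (\<forall>x\<in>X. F x m = g x) \<and>
     (\<forall>x\<in>X. dig_continuous {0..m} int_adj Y \<mu> (\<lambda>t. F x t)) \<and>
     (\<forall>t\<in>{0..m}. dig_continuous X \<kappa> Y \<mu> (\<lambda>x. F x t))"

definition dig_homotopic ::
    "'a set \<Rightarrow> ('a \<Rightarrow> 'a \<Rightarrow> bool) \<Rightarrow> 'b set \<Rightarrow> ('b \<Rightarrow> 'b \<Rightarrow> bool) \<Rightarrow> ('a \<Rightarrow> 'b) \<Rightarrow> ('a \<Rightarrow> 'b) \<Rightarrow> bool" where
  "dig_homotopic X \<kappa> Y \<mu> f g \<longleftrightarrow> (\<exists>m F. dig_homotopy X \<kappa> Y \<mu> f g m F)"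

definition dig_homotopic_fixing ::
    "'a \<Rightarrow> 'a set \<Rightarrow> ('a \<Rightarrow> 'a \<Rightarrow> bool) \<Rightarrow> 'b set \<Rightarrow> ('b \<Rightarrow> 'b \<Rightarrow> bool) \<Rightarrow> ('a \<Rightarrow> 'b) \<Rightarrow> ('a \<Rightarrow> 'b) \<Rightarrow> bool" where
  "dig_homotopic_fixing x0 X \<kappa> Y \<mu> f g \<longleftrightarrow>
     (\<exists>m F. dig_homotopy X \<kappa> Y \<mu> f g m F \<and> (\<forall>t\<in>{0..m}. F x0 t = F x0 0))"

definition same_homotopy_type ::
    "'a set \<Rightarrow> ('a \<Rightarrow> 'a \<Rightarrow> bool) \<Rightarrow> 'b set \<Rightarrow> ('b \<Rightarrow> 'b \<Rightarrow> bool) \<Rightarrow> bool" where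
  "same_homotopy_type X \<kappa> Y \<mu> \<longleftrightarrow>
     (\<exists>f g. dig_continuous X \<kappa> Y \<mu> f \<and> dig_continuous Y \<mu> X \<kappa> g \<and>
            dig_homotopic X \<kappa> X \<kappa> (g \<circ> f) id \<and> dig_homotopic Y \<mu> Y \<mu> (f \<circ> g) id)"

definition same_pointed_homotopy_type ::
    "'a set \<Rightarrow> ('a \<Rightarrow> 'a \<Rightarrow> bool) \<Rightarrow> 'a \<Rightarrow> 'b set \<Rightarrow> ('b \<Rightarrow> 'b \<Rightarrow> bool) \<Rightarrow> 'b \<Rightarrow> bool" where
  "same_pointed_homotopy_type X \<kappa> x0 Y \<mu> y0 \<longleftrightarrow>
     (\<exists>f g. dig_continuous X \<kappa> Y \<mu> f \<and> dig_continuous Y \<mu> X \<kappa> g \<and>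
            f x0 = y0 \<and> g y0 = x0 \<and>
            dig_homotopic_fixing x0 X \<kappa> X \<kappa> (g \<circ> f) id \<and>
            dig_homotopic_fixing y0 Y \<mu> Y \<mu> (f \<circ> g) id)"

text \<open>
  In the next definition the one-sided intervals are not intersected with the unit interval:
  any radius may be decreased, so it can always be chosen such that the intervals
  lie inside it, and the values of \<open>p\<close> outside the unit interval are irrelevant.
\<close>

definition real_dig_path :: "'b set \<Rightarrow> ('b \<Rightarrow> 'b \<Rightarrow> bool) \<Rightarrow> (real \<Rightarrow> 'b) \<Rightarrow> bool" where
  "real_dig_path Y \<mu> p \<longleftrightarrow>
     p ` {0..1} \<subseteq> Y \<and>
     (\<exists>e>0. \<exists>v. (\<forall>s\<in>{0<..<e}. p s = v) \<and> adj_or_eq \<mu> v (p 0)) \<and>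
     (\<exists>e>0. \<exists>v. (\<forall>s\<in>{1-e<..<1}. p s = v) \<and> adj_or_eq \<mu> v (p 1)) \<and>
     (\<forall>t\<in>{0<..<1}. \<exists>e>0. \<exists>u v.
        (\<forall>s\<in>{t-e<..<t}. p s = u) \<and> (\<forall>s\<in>{t<..<t+e}. p s = v) \<and>
        adj_or_eq \<mu> u v \<and> (p t = u \<or> p t = v))"

definition real_dig_homotopy ::
    "'a set \<Rightarrow> ('a \<Rightarrow> 'a \<Rightarrow> bool) \<Rightarrow> 'b set \<Rightarrow> ('b \<Rightarrow> 'b \<Rightarrow> bool) \<Rightarrow> ('a \<Rightarrow> 'b) \<Rightarrow> ('a \<Rightarrow> 'b)
      \<Rightarrow> ('a \<Rightarrow> real \<Rightarrow> 'b) \<Rightarrow> bool" where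
  "real_dig_homotopy X \<kappa> Y \<mu> f g F \<longleftrightarrow>
     dig_continuous X \<kappa> Y \<mu> f \<and> dig_continuous X \<kappa> Y \<mu> g \<and>
     (\<forall>x\<in>X. F x 0 = f x) \<and> (\<forall>x\<in>X. F x 1 = g x) \<and>
     (\<forall>x\<in>X. real_dig_path Y \<mu> (\<lambda>t. F x t)) \<and>
     (\<forall>t\<in>{0..1}. dig_continuous X \<kappa> Y \<mu> (\<lambda>x. F x t))"

definition real_dig_homotopic ::
    "'a set \<Rightarrow> ('a \<Rightarrow> 'a \<Rightarrow> bool) \<Rightarrow> 'b set \<Rightarrow> ('b \<Rightarrow> 'b \<Rightarrow> bool) \<Rightarrow> ('a \<Rightarrow> 'b) \<Rightarrow> ('a \<Rightarrow> 'b) \<Rightarrow> bool" where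
  "real_dig_homotopic X \<kappa> Y \<mu> f g \<longleftrightarrow> (\<exists>F. real_dig_homotopy X \<kappa> Y \<mu> f g F)"

definition real_dig_homotopic_const_at ::
    "'a \<Rightarrow> 'b \<Rightarrow> 'a set \<Rightarrow> ('a \<Rightarrow> 'a \<Rightarrow> bool) \<Rightarrow> 'b set \<Rightarrow> ('b \<Rightarrow> 'b \<Rightarrow> bool) \<Rightarrow> ('a \<Rightarrow> 'b) \<Rightarrow> ('a \<Rightarrow> 'b) \<Rightarrow> bool" where
  "real_dig_homotopic_const_at x0 y0 X \<kappa> Y \<mu> f g \<longleftrightarrow>
     (\<exists>F. real_dig_homotopy X \<kappa> Y \<mu> f g F \<and> (\<forall>t\<in>{0..1}. F x0 t = y0))"

definition same_real_homotopy_type ::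
    "'a set \<Rightarrow> ('a \<Rightarrow> 'a \<Rightarrow> bool) \<Rightarrow> 'b set \<Rightarrow> ('b \<Rightarrow> 'b \<Rightarrow> bool) \<Rightarrow> bool" where
  "same_real_homotopy_type X \<kappa> Y \<mu> \<longleftrightarrow>
     (\<exists>f g. dig_continuous X \<kappa> Y \<mu> f \<and> dig_continuous Y \<mu> X \<kappa> g \<and>
            real_dig_homotopic X \<kappa> X \<kappa> (g \<circ> f) id \<and> real_dig_homotopic Y \<mu> Y \<mu> (f \<circ> g) id)"

definition same_pointed_real_homotopy_type ::
    "'a set \<Rightarrow> ('a \<Rightarrow> 'a \<Rightarrow> bool) \<Rightarrow> 'a \<Rightarrow> 'b set \<Rightarrow> ('b \<Rightarrow> 'b \<Rightarrow> bool) \<Rightarrow> 'b \<Rightarrow> bool" where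
  "same_pointed_real_homotopy_type X \<kappa> x0 Y \<mu> y0 \<longleftrightarrow>
     (\<exists>f g. dig_continuous X \<kappa> Y \<mu> f \<and> dig_continuous Y \<mu> X \<kappa> g \<and>
            f x0 = y0 \<and> g y0 = x0 \<and>
            real_dig_homotopic_const_at x0 x0 X \<kappa> X \<kappa> (g \<circ> f) id \<and>
            real_dig_homotopic_const_at y0 y0 Y \<mu> Y \<mu> (f \<circ> g) id)"

end

theory Submission
  imports Defs
begin

text \<open>
  A digital homotopy with time interval \<open>{0..m}\<close> is reparametrised to a real one by
  \<open>t \<mapsto> \<lfloor>m t\<rfloor>\<close>. Conversely, call two continuous maps neighbours if they are pointwise
  equal or adjacent. If the domain is finite, then each stage of a real homotopy is a
  neighbour of all stages at sufficiently close times, so by connectedness of the unit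
  interval the two ends are joined by a finite chain of neighbours, which is a digital homotopy.
\<close>

section \<open>Continuity as preservation of adjacency up to equality\<close>

lemma adj_or_eq_refl [simp]: "adj_or_eq \<mu> x x"
  by (simp add: adj_or_eq_def)

lemma adj_or_eq_sym:
  assumes "symp_on Y \<mu>" "x \<in> Y" "y \<in> Y" "adj_or_eq \<mu> x y"
  shows "adj_or_eq \<mu> y x"
  using assms unfolding adj_or_eq_def by (metis symp_onD)

text \<open>A sequence confined to two points can leave \<open>a\<close> only by a step to
  \<open>b\<close>; repetitions of \<open>a\<close> before that step are consumed by the
  induction.\<close>

lemma successively_two_point_imp_related:
  assumes "successively R ps" "ps \<noteq> []" "hd ps = a" "last ps = b" "set ps \<subseteq> {a, b}" "a \<noteq> b"
  shows "R a b"
  using assms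
proof (induction ps)
  case Nil
  then show ?case by simp
next
  case (Cons c ps)
  show ?case
  proof (cases ps)
    case Nil
    then show ?thesis using Cons.prems by simp
  next
    case (Cons d qs)
    then show ?thesis using Cons.prems Cons.IH by auto
  qed
qed

text \<open>Mapping \<open>f\<close> over \<open>ps\<close> may produce equal consecutive entries,
  and \<open>\<mu>\<close> need not relate a point to itself. Such repetitions are dropped, so
  \<open>qs\<close> can be shorter than \<open>ps\<close>.\<close>

lemma successively_image:
  assumes "successively \<kappa> ps" "ps \<noteq> []" "set ps \<subseteq> X"
    and adj: "\<And>x y. x \<in> X \<Longrightarrow> y \<in> X \<Longrightarrow> \<kappa> x y \<Longrightarrow> adj_or_eq \<mu> (f x) (f y)"
  shows "\<exists>qs. qs \<noteq> [] \<and> hd qs = f (hd ps) \<and> last qs = f (last ps) \<and>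
    set qs \<subseteq> f ` set ps \<and> successively \<mu> qs"
  using assms(1-3)
proof (induction ps)
  case Nil
  then show ?case by simp
next
  case (Cons c ps)
  show ?case
  proof (cases ps)
    case Nil
    then show ?thesis by (intro exI[of _ "[f c]"]) simp
  next
    case (Cons d rs)
    with Cons.IH Cons.prems obtain qs where qs: "qs \<noteq> []" "hd qs = f (hd ps)"
      "last qs = f (last ps)" "set qs \<subseteq> f ` set ps" "successively \<mu> qs"
      by auto
    have "adj_or_eq \<mu> (f c) (f d)"
      using Cons.prems Cons by (intro adj) auto
    then consider "f c = f d" | "\<mu> (f c) (f d)"
      unfolding adj_or_eq_def by blast
    then show ?thesis
    proof cases
      case 1
      with qs Cons show ?thesis by (intro exI[of _ qs]) auto
    next
      case 2
      with qs Cons show ?thesis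
        by (intro exI[of _ "f c # qs"]) (auto simp: successively_Cons)
    qed
  qed
qed

text \<open>By symmetry two adjacent points form a connected set; its image is connected and has at
  most two points, so the image points are equal or adjacent. Conversely, a sequence joining two
  points of a connected set is carried to one joining their images. All later continuity arguments
  for paths use this criterion.\<close>

lemma dig_continuous_iff_adj:
  assumes "symp_on X \<kappa>"
  shows "dig_continuous X \<kappa> Y \<mu> f \<longleftrightarrow>
    f ` X \<subseteq> Y \<and> (\<forall>x\<in>X. \<forall>y\<in>X. \<kappa> x y \<longrightarrow> adj_or_eq \<mu> (f x) (f y))"
proof (intro iffI conjI ballI impI)
  assume f: "dig_continuous X \<kappa> Y \<mu> f"
  then show "f ` X \<subseteq> Y" by (simp add: dig_continuous_def)
  fix x y assume xy: "x \<in> X" "y \<in> X" "\<kappa> x y"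
  then have yx: "\<kappa> y x" using assms by (metis symp_onD)
  have "dig_connected \<kappa> {x, y}"
    unfolding dig_connected_def
  proof (intro ballI impI)
    fix a b assume "a \<in> {x, y}" "b \<in> {x, y}" "a \<noteq> b"
    then show "\<exists>ps. ps \<noteq> [] \<and> hd ps = a \<and> last ps = b \<and> set ps \<subseteq> {x, y} \<and> successively \<kappa> ps"
      using xy yx by (intro exI[of _ "[a, b]"]) auto
  qed
  moreover have "{x, y} \<subseteq> X" using xy by simp
  ultimately have conn: "dig_connected \<mu> (f ` {x, y})"
    using f unfolding dig_continuous_def by metis
  show "adj_or_eq \<mu> (f x) (f y)"
  proof (cases "f x = f y")
    case False
    with conn obtain ps where "ps \<noteq> []" "hd ps = f x" "last ps = f y"
      "set ps \<subseteq> {f x, f y}" "successively \<mu> ps"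
      unfolding dig_connected_def by auto
    then show ?thesis
      using successively_two_point_imp_related False unfolding adj_or_eq_def by metis
  qed simp
next
  assume f: "f ` X \<subseteq> Y \<and> (\<forall>x\<in>X. \<forall>y\<in>X. \<kappa> x y \<longrightarrow> adj_or_eq \<mu> (f x) (f y))"
  show "dig_continuous X \<kappa> Y \<mu> f"
    unfolding dig_continuous_def
  proof (intro conjI allI impI)
    show "f ` X \<subseteq> Y" using f by blast
    fix A assume A: "A \<subseteq> X" "dig_connected \<kappa> A"
    show "dig_connected \<mu> (f ` A)"
      unfolding dig_connected_def
    proof (intro ballI impI)
      fix u v assume "u \<in> f ` A" "v \<in> f ` A" "u \<noteq> v"
      then obtain x y where xy: "x \<in> A" "y \<in> A" "u = f x" "v = f y" "x \<noteq> y" by auto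
      with A obtain ps where ps: "ps \<noteq> []" "hd ps = x" "last ps = y" "set ps \<subseteq> A"
        "successively \<kappa> ps"
        unfolding dig_connected_def by meson
      have "\<exists>qs. qs \<noteq> [] \<and> hd qs = f (hd ps) \<and> last qs = f (last ps) \<and>
          set qs \<subseteq> f ` set ps \<and> successively \<mu> qs"
        using ps A f by (intro successively_image[where X = X and \<kappa> = \<kappa>]) auto
      then obtain qs where "qs \<noteq> []" "hd qs = u" "last qs = v" "set qs \<subseteq> f ` set ps"
        "successively \<mu> qs"
        using ps xy by auto
      then show "\<exists>qs. qs \<noteq> [] \<and> hd qs = u \<and> last qs = v \<and> set qs \<subseteq> f ` A \<and> successively \<mu> qs"
        using ps(4) by blast
    qed
  qed
qed

section \<open>From digital homotopies to real homotopies\<close>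

lemma symp_on_int_adj [simp]: "symp_on A int_adj"
  unfolding int_adj_def by (intro symp_onI) simp

lemma floor_scaled_unit_interval:
  fixes t :: real
  assumes "0 \<le> m" "t \<in> {0..1}"
  shows "\<lfloor>of_int m * t\<rfloor> \<in> {0..m}"
proof -
  have "of_int m * t \<le> of_int m" using assms by (simp add: mult_left_le)
  then have "\<lfloor>of_int m * t\<rfloor> \<le> m" by linarith
  then show ?thesis using assms by simp
qed

text \<open>The index \<open>\<lfloor>of_int m * t\<rfloor>\<close> jumps only where
  \<open>of_int m * t\<close> is an integer, and then by one. The one-sided values at any time are
  therefore values of \<open>c\<close> at equal or consecutive indices, and the value at an interior
  time is the right-hand one.\<close>

lemma dig_path_imp_real_dig_path:
  assumes c: "dig_continuous {0..m} int_adj Y \<mu> c" and m: "0 < m"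
  shows "real_dig_path Y \<mu> (\<lambda>t. c \<lfloor>of_int m * t\<rfloor>)"
proof -
  have rng: "c k \<in> Y" if "0 \<le> k" "k \<le> m" for k
    using c that unfolding dig_continuous_def by auto
  have step: "adj_or_eq \<mu> (c (k - 1)) (c k)" if "1 \<le> k" "k \<le> m" for k
    using c that by (auto simp: dig_continuous_iff_adj int_adj_def)
  \<comment> \<open>These are the distances from \<open>t\<close> to the nearest jump times strictly
    before and strictly after it: \<open>\<lceil>of_int m * t\<rceil> - 1\<close> and
    \<open>\<lfloor>of_int m * t\<rfloor> + 1\<close> are the integers next to
    \<open>of_int m * t\<close> on either side, also when \<open>of_int m * t\<close> is itself an
    integer. Hence both radii are positive.\<close>
  define l r where "l t = (of_int m * t - of_int (\<lceil>of_int m * t\<rceil> - 1)) / of_int m"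
    and "r t = (of_int (\<lfloor>of_int m * t\<rfloor> + 1) - of_int m * t) / of_int m" for t :: real
  have m': "(of_int m :: real) > 0" using m by simp
  have lpos: "l t > 0" and rpos: "r t > 0" for t
    unfolding l_def r_def using m' by (intro divide_pos_pos; linarith)+
  have left: "\<lfloor>of_int m * s\<rfloor> = \<lceil>of_int m * t\<rceil> - 1" if "t - l t < s" "s < t" for s t :: real
  proof -
    have "of_int m * (t - s) < of_int m * l t"
      using that m' by (intro mult_strict_left_mono) auto
    moreover have "of_int m * l t = of_int m * t - of_int (\<lceil>of_int m * t\<rceil> - 1)"
      unfolding l_def using m' by simp
    moreover have "of_int m * s < of_int m * t" using that m' by simp
    moreover have "of_int m * t \<le> of_int \<lceil>of_int m * t\<rceil>" by simp
    ultimately have "of_int m * s < of_int \<lceil>of_int m * t\<rceil>"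
      "of_int (\<lceil>of_int m * t\<rceil> - 1) < of_int m * s"
      by (linarith, simp add: right_diff_distrib)
    then show ?thesis by (simp add: floor_eq_iff)
  qed
  have right: "\<lfloor>of_int m * s\<rfloor> = \<lfloor>of_int m * t\<rfloor>" if "t < s" "s < t + r t" for s t :: real
  proof -
    have "of_int m * (s - t) < of_int m * r t"
      using that m' by (intro mult_strict_left_mono) auto
    moreover have "of_int m * r t = of_int (\<lfloor>of_int m * t\<rfloor> + 1) - of_int m * t"
      unfolding r_def using m' by simp
    moreover have "of_int m * t < of_int m * s" using that m' by simp
    moreover have "of_int \<lfloor>of_int m * t\<rfloor> \<le> of_int m * t" by simp
    ultimately have "of_int \<lfloor>of_int m * t\<rfloor> \<le> of_int m * s"
      "of_int m * s < of_int (\<lfloor>of_int m * t\<rfloor> + 1)"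
      by (linarith, simp add: right_diff_distrib)
    then show ?thesis by (simp add: floor_eq_iff)
  qed
  have unit: "0 \<le> \<lfloor>of_int m * t\<rfloor>" "\<lfloor>of_int m * t\<rfloor> \<le> m" if "0 \<le> t" "t \<le> 1" for t :: real
    using floor_scaled_unit_interval[of m t] m that by auto
  show ?thesis
    unfolding real_dig_path_def
  proof (intro conjI ballI)
    show "(\<lambda>t. c \<lfloor>of_int m * t\<rfloor>) ` {0..1::real} \<subseteq> Y"
      using rng unit by auto
    show "\<exists>e>0. \<exists>v. (\<forall>s\<in>{0<..<e::real}. c \<lfloor>of_int m * s\<rfloor> = v) \<and> adj_or_eq \<mu> v (c \<lfloor>of_int m * (0::real)\<rfloor>)"
      using rpos[of 0] right[of 0]
      by (intro exI[of _ "r 0"] exI[of _ "c 0"]) auto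
    \<comment> \<open>Within the unit interval the index \<open>m\<close> is reached only at time 1;
      just before, the index is \<open>m - 1\<close>.\<close>
    show "\<exists>e>0. \<exists>v. (\<forall>s\<in>{1 - e<..<1::real}. c \<lfloor>of_int m * s\<rfloor> = v) \<and> adj_or_eq \<mu> v (c \<lfloor>of_int m * (1::real)\<rfloor>)"
      using lpos[of 1] left[of 1] step[of m] m
      by (intro exI[of _ "l 1"] exI[of _ "c (m - 1)"]) auto
    fix t :: real assume t: "t \<in> {0<..<1}"
    show "\<exists>e>0. \<exists>u v. (\<forall>s\<in>{t - e<..<t}. c \<lfloor>of_int m * s\<rfloor> = u) \<and>
        (\<forall>s\<in>{t<..<t + e}. c \<lfloor>of_int m * s\<rfloor> = v) \<and> adj_or_eq \<mu> u v \<and>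
        (c \<lfloor>of_int m * t\<rfloor> = u \<or> c \<lfloor>of_int m * t\<rfloor> = v)"
    proof (intro exI conjI)
      show "0 < min (l t) (r t)" using lpos rpos by simp
      show "\<forall>s\<in>{t - min (l t) (r t)<..<t}. c \<lfloor>of_int m * s\<rfloor> = c (\<lceil>of_int m * t\<rceil> - 1)"
        using left[of t] by auto
      show "\<forall>s\<in>{t<..<t + min (l t) (r t)}. c \<lfloor>of_int m * s\<rfloor> = c \<lfloor>of_int m * t\<rfloor>"
        using right[of t] by auto
      \<comment> \<open>If \<open>of_int m * t\<close> is an integer \<open>k\<close>, the two
        values are \<open>c (k - 1)\<close> and \<open>c k\<close> with \<open>0 < k\<close> and
        \<open>k \<le> m\<close>, a single step of \<open>c\<close>. Otherwise ceiling minus one is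
        the floor and the two values coincide.\<close>
      show "adj_or_eq \<mu> (c (\<lceil>of_int m * t\<rceil> - 1)) (c \<lfloor>of_int m * t\<rfloor>)"
      proof (cases "of_int m * t \<in> \<int>")
        case True
        then obtain k where k: "of_int m * t = of_int k" by (elim Ints_cases)
        have "0 < k" using k m t by (metis greaterThanLessThan_iff mult_pos_pos of_int_0_less_iff)
        moreover have "k \<le> m" using unit[of t] t k by simp
        ultimately show ?thesis using k step[of k] by simp
      next
        case False
        then have "\<lceil>of_int m * t\<rceil> = \<lfloor>of_int m * t\<rfloor> + 1"
          by (simp add: ceiling_altdef) (metis Ints_of_int)
        then show ?thesis by simp
      qed
      show "c \<lfloor>of_int m * t\<rfloor> = c (\<lceil>of_int m * t\<rceil> - 1) \<or> c \<lfloor>of_int m * t\<rfloor> = c \<lfloor>of_int m * t\<rfloor>"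
        by simp
    qed
  qed
qed

text \<open>Every stage of the new family is a stage of \<open>F\<close>, so it is continuous, and
  the times 0 and 1 have the indices 0 and \<open>m\<close>. Points fixed by \<open>F\<close> stay
  fixed.\<close>

lemma dig_homotopy_imp_real_dig_homotopy:
  assumes F: "dig_homotopy X \<kappa> Y \<mu> f g m F"
  shows "real_dig_homotopy X \<kappa> Y \<mu> f g (\<lambda>x t. F x \<lfloor>of_int m * t\<rfloor>)"
proof -
  have m: "0 < m" using F by (simp add: dig_homotopy_def)
  have "\<lfloor>of_int m * t\<rfloor> \<in> {0..m}" if "t \<in> {0..1}" for t :: real
    using floor_scaled_unit_interval[of m t] m that by simp
  with F m show ?thesis
    unfolding real_dig_homotopy_def dig_homotopy_def
    by (auto intro!: dig_path_imp_real_dig_path)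
qed

lemma dig_homotopic_fixing_imp_real_dig_homotopic_const_at:
  assumes "dig_homotopic_fixing x0 X \<kappa> Y \<mu> f g" "x0 \<in> X"
  shows "real_dig_homotopic_const_at x0 (f x0) X \<kappa> Y \<mu> f g"
proof -
  from assms obtain m F where F: "dig_homotopy X \<kappa> Y \<mu> f g m F" "\<forall>t\<in>{0..m}. F x0 t = F x0 0"
    unfolding dig_homotopic_fixing_def by blast
  have m: "0 < m" and f: "F x0 0 = f x0" using F assms(2) by (auto simp: dig_homotopy_def)
  have "F x0 \<lfloor>of_int m * t\<rfloor> = f x0" if "t \<in> {0..1}" for t :: real
    using floor_scaled_unit_interval[of m t] F f m that by simp
  then show ?thesis
    unfolding real_dig_homotopic_const_at_def
    using dig_homotopy_imp_real_dig_homotopy[OF F(1)] by blast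
qed

section \<open>From real homotopies to digital homotopies on a finite domain\<close>

text \<open>Close to \<open>t\<close> the path takes only its one-sided values. At an interior time
  \<open>p t\<close> is one of them and they are equal or adjacent to each other; at an end point
  the single one-sided value is equal or adjacent to \<open>p t\<close>.\<close>

lemma real_dig_path_eventually_adj:
  assumes p: "real_dig_path Y \<mu> p" and Y: "symp_on Y \<mu>" and t: "t \<in> {0..1}"
  shows "eventually (\<lambda>s. adj_or_eq \<mu> (p t) (p s)) (at t within {0..1})"
proof -
  have rng: "p s \<in> Y" if "s \<in> {0..1}" for s using p that by (auto simp: real_dig_path_def)
  have "\<exists>d>0. \<forall>s\<in>{0..1}. s \<noteq> t \<and> dist s t < d \<longrightarrow> adj_or_eq \<mu> (p s) (p t) \<or> adj_or_eq \<mu> (p t) (p s)"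
  proof -
    consider "t = 0" | "t = 1" | "t \<in> {0<..<1}" using t by force
    then show ?thesis
    proof cases
      case 1
      with p obtain e v where "e > 0" "\<forall>s\<in>{0<..<e}. p s = v" "adj_or_eq \<mu> v (p 0)"
        unfolding real_dig_path_def by blast
      with 1 show ?thesis by (intro exI[of _ e]) (auto simp: dist_real_def)
    next
      case 2
      with p obtain e v where "e > 0" "\<forall>s\<in>{1-e<..<1}. p s = v" "adj_or_eq \<mu> v (p 1)"
        unfolding real_dig_path_def by blast
      with 2 show ?thesis by (intro exI[of _ e]) (auto simp: dist_real_def)
    next
      case 3
      with p obtain e u v where e: "e > 0" "\<forall>s\<in>{t-e<..<t}. p s = u"
        "\<forall>s\<in>{t<..<t+e}. p s = v" "adj_or_eq \<mu> u v" "p t = u \<or> p t = v"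
        unfolding real_dig_path_def by meson
      have "adj_or_eq \<mu> (p s) (p t) \<or> adj_or_eq \<mu> (p t) (p s)" if s: "s \<noteq> t" "dist s t < e" for s
      proof (cases "s < t")
        case True
        then have "p s = u" using s e(2) by (auto simp: dist_real_def)
        then show ?thesis using e(4,5) by auto
      next
        case False
        then have "p s = v" using s e(3) by (auto simp: dist_real_def)
        then show ?thesis using e(4,5) by auto
      qed
      with e(1) show ?thesis by blast
    qed
  qed
  then obtain d where d: "d > 0" "\<And>s. s \<in> {0..1} \<Longrightarrow> s \<noteq> t \<Longrightarrow> dist s t < d \<Longrightarrow>
      adj_or_eq \<mu> (p s) (p t) \<or> adj_or_eq \<mu> (p t) (p s)"
    by blast
  have "adj_or_eq \<mu> (p t) (p s)" if "s \<in> {0..1}" "s \<noteq> t" "dist s t < d" for s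
    using d(2)[OF that] adj_or_eq_sym[OF Y rng[OF that(1)] rng[OF t]] by blast
  with d(1) show ?thesis
    unfolding eventually_at by (intro exI[of _ d]) simp
qed

text \<open>The set \<open>A\<close> collects the points to be held fixed: \<open>{}\<close> serves
  free homotopies and \<open>{x0}\<close> pointed ones, so one argument covers both. Continuity is
  built in so that every map in a chain can be a stage of a homotopy.\<close>

definition neighbour_maps ::
    "'a set \<Rightarrow> 'a set \<Rightarrow> ('a \<Rightarrow> 'a \<Rightarrow> bool) \<Rightarrow> 'b set \<Rightarrow> ('b \<Rightarrow> 'b \<Rightarrow> bool) \<Rightarrow>
      ('a \<Rightarrow> 'b) \<Rightarrow> ('a \<Rightarrow> 'b) \<Rightarrow> bool" where
  "neighbour_maps A X \<kappa> Y \<mu> f g \<longleftrightarrow>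
     dig_continuous X \<kappa> Y \<mu> f \<and> dig_continuous X \<kappa> Y \<mu> g \<and>
     (\<forall>x\<in>X. adj_or_eq \<mu> (f x) (g x)) \<and> (\<forall>x\<in>A. f x = g x)"

lemma neighbour_maps_sym:
  assumes "symp_on Y \<mu>" "neighbour_maps A X \<kappa> Y \<mu> f g"
  shows "neighbour_maps A X \<kappa> Y \<mu> g f"
proof -
  have "f x \<in> Y" "g x \<in> Y" if "x \<in> X" for x
    using assms that by (auto simp: neighbour_maps_def dig_continuous_def)
  then show ?thesis
    using assms adj_or_eq_sym[OF assms(1)] by (auto simp: neighbour_maps_def)
qed

text \<open>The maps of the chain, numbered from 0, are the stages at integer times. The chain has
  at least one link because a digital homotopy has positive length.\<close>

lemma neighbour_chain_imp_dig_homotopy: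
  assumes chain: "(neighbour_maps A X \<kappa> Y \<mu>)\<^sup>+\<^sup>+ f g" and Y: "symp_on Y \<mu>"
  shows "\<exists>m F. dig_homotopy X \<kappa> Y \<mu> f g m F \<and> (\<forall>x\<in>A. \<forall>t\<in>{0..m}. F x t = F x 0)"
proof -
  from chain obtain n where n: "n > 0" "(neighbour_maps A X \<kappa> Y \<mu> ^^ n) f g"
    by (metis tranclp_power)
  then obtain h where h: "h 0 = f" "h n = g"
    "\<And>i. i < n \<Longrightarrow> neighbour_maps A X \<kappa> Y \<mu> (h i) (h (Suc i))"
    by (auto simp: relpowp_fun_conv)
  \<comment> \<open>The last map starts no link, so its continuity is read off the link that begins
    at \<open>n - 1\<close>.\<close>
  have cont: "dig_continuous X \<kappa> Y \<mu> (h i)" if "i \<le> n" for i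
    using h(3)[of i] h(3)[of "i - 1"] that n(1)
    by (cases "i = n") (auto simp: neighbour_maps_def)
  then have rng: "h i x \<in> Y" if "i \<le> n" "x \<in> X" for i x
    using that by (auto simp: dig_continuous_def)
  \<comment> \<open>Both orders are recorded because \<open>int_adj\<close> relates consecutive
    times in either direction.\<close>
  have adj: "adj_or_eq \<mu> (h i x) (h (Suc i) x)" "adj_or_eq \<mu> (h (Suc i) x) (h i x)"
    if "i < n" "x \<in> X" for i x
    using h(3)[OF that(1)] neighbour_maps_sym[OF Y h(3)[OF that(1)]] that(2)
    by (auto simp: neighbour_maps_def)
  have fixed: "h i x = h 0 x" if "i \<le> n" "x \<in> A" for i x
    using that(1)
  proof (induction i)
    case (Suc i)
    then show ?case using h(3)[of i] that(2) by (auto simp: neighbour_maps_def)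
  qed simp
  have path: "dig_continuous {0..int n} int_adj Y \<mu> (\<lambda>t. h (nat t) x)" if x: "x \<in> X" for x
    unfolding dig_continuous_iff_adj[OF symp_on_int_adj]
  proof (intro conjI ballI impI)
    show "(\<lambda>t. h (nat t) x) ` {0..int n} \<subseteq> Y" using rng x by auto
    fix s t assume "s \<in> {0..int n}" "t \<in> {0..int n}" "int_adj s t"
    then have "(nat s < n \<and> nat t = Suc (nat s)) \<or> (nat t < n \<and> nat s = Suc (nat t))"
      unfolding int_adj_def by (auto simp: abs_if split: if_splits)
    then show "adj_or_eq \<mu> (h (nat s) x) (h (nat t) x)"
      using adj x by auto
  qed
  have "dig_homotopy X \<kappa> Y \<mu> f g (int n) (\<lambda>x t. h (nat t) x)"
    unfolding dig_homotopy_def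
  proof (intro conjI ballI)
    show "dig_continuous X \<kappa> Y \<mu> f" "dig_continuous X \<kappa> Y \<mu> g"
      using cont[of 0] cont[of n] h(1,2) by simp_all
    show "dig_continuous X \<kappa> Y \<mu> (\<lambda>x. h (nat t) x)" if "t \<in> {0..int n}" for t
      using cont[of "nat t"] that by (simp add: nat_le_iff)
  qed (use n(1) h(1,2) path in simp_all)
  moreover have "\<forall>x\<in>A. \<forall>t\<in>{0..int n}. h (nat t) x = h (nat 0) x"
  proof (intro ballI)
    fix x t assume "x \<in> A" "t \<in> {0..int n}"
    then show "h (nat t) x = h (nat 0) x"
      using fixed[of "nat t" x] by (simp add: nat_le_iff)
  qed
  ultimately show ?thesis by blast
qed

lemma real_dig_homotopy_imp_dig_homotopy:
  assumes F: "real_dig_homotopy X \<kappa> Y \<mu> f g F" and Y: "symp_on Y \<mu>" and fin: "finite X"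
    and A: "A \<subseteq> X" "\<And>x t. x \<in> A \<Longrightarrow> t \<in> {0..1} \<Longrightarrow> F x t = F x 0"
  shows "\<exists>m G. dig_homotopy X \<kappa> Y \<mu> f g m G \<and> (\<forall>x\<in>A. \<forall>t\<in>{0..m}. G x t = G x 0)"
proof -
  define N where "N = neighbour_maps A X \<kappa> Y \<mu>"
  let ?R = "\<lambda>s t. N\<^sup>+\<^sup>+ (\<lambda>x. F x s) (\<lambda>x. F x t)"
  have nb: "eventually (\<lambda>s. N (\<lambda>x. F x t) (\<lambda>x. F x s)) (at t within {0..1})"
    if t: "t \<in> {0..1}" for t
  proof -
    \<comment> \<open>Here finiteness enters: the neighbourhoods of \<open>t\<close> obtained for
      the single points of \<open>X\<close> are intersected into one that works for all
      points.\<close>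
    have "eventually (\<lambda>s. \<forall>x\<in>X. adj_or_eq \<mu> (F x t) (F x s)) (at t within {0..1})"
      using F t
      by (intro eventually_ball_finite[OF fin] ballI real_dig_path_eventually_adj[OF _ Y])
        (auto simp: real_dig_homotopy_def)
    \<comment> \<open>For \<open>s\<close> in the unit interval the stage at \<open>s\<close> is
      continuous, and on \<open>A\<close> the stages at \<open>s\<close> and \<open>t\<close> both
      agree with the one at time 0.\<close>
    moreover have "eventually (\<lambda>s. s \<in> {0..1}) (at t within {0..1})"
      by (auto simp: eventually_at_filter)
    ultimately show ?thesis
    proof eventually_elim
      case (elim s)
      then show ?case
        using F t A(2)[of _ s] A(2)[of _ t]
        unfolding N_def neighbour_maps_def real_dig_homotopy_def by auto
    qed
  qed
  have "?R 0 1"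
  \<comment> \<open>Each time has a relatively open neighbourhood of times related to it. By
    symmetry and transitivity the classes of \<open>?R\<close> in the unit interval are open, so
    connectedness leaves only one.\<close>
  proof (rule connected_equivalence_relation[of "{0..1::real}" 0 1 ?R])
    show "?R t s" if "?R s t" for s t
    proof -
      have "symp N" unfolding N_def by (rule sympI) (rule neighbour_maps_sym[OF Y])
      then have "symp N\<^sup>+\<^sup>+" by (rule sym_trancl[to_pred])
      from sympD[OF this, OF that] show ?thesis .
    qed
    show "\<exists>T. openin (top_of_set {0..1}) T \<and> t \<in> T \<and> (\<forall>s\<in>T. ?R t s)" if t: "t \<in> {0..1}" for t
    proof -
      from nb[OF t] obtain U where U: "open U" "t \<in> U"
        "\<And>s. s \<in> U \<Longrightarrow> s \<noteq> t \<Longrightarrow> s \<in> {0..1} \<Longrightarrow> N (\<lambda>x. F x t) (\<lambda>x. F x s)"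
        unfolding eventually_at_topological by blast
      \<comment> \<open>The filter \<open>at t within {0..1}\<close> says nothing about
        \<open>t\<close> itself, so that time is added separately.\<close>
      have "N (\<lambda>x. F x t) (\<lambda>x. F x t)"
        using F t unfolding N_def neighbour_maps_def real_dig_homotopy_def by simp
      then have "N (\<lambda>x. F x t) (\<lambda>x. F x s)" if "s \<in> {0..1} \<inter> U" for s
        using U(3)[of s] that by (cases "s = t") auto
      then have "\<forall>s\<in>{0..1} \<inter> U. ?R t s" by blast
      with U t show ?thesis by (intro exI[of _ "{0..1} \<inter> U"]) (auto simp: openin_open_Int)
    qed
    show "?R s u" if "?R s t" "?R t u" for s t u
      using that by (rule tranclp_trans)
  qed auto
  then obtain m G where G:
    "dig_homotopy X \<kappa> Y \<mu> (\<lambda>x. F x 0) (\<lambda>x. F x 1) m G" "\<forall>x\<in>A. \<forall>t\<in>{0..m}. G x t = G x 0"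
    unfolding N_def using neighbour_chain_imp_dig_homotopy[OF _ Y] by blast
  \<comment> \<open>Off \<open>X\<close> the stages at times 0 and 1 may differ from
    \<open>f\<close> and \<open>g\<close>; a homotopy compares its ends with them only on
    \<open>X\<close>, and continuity of \<open>f\<close> and \<open>g\<close> comes from
    \<open>F\<close>.\<close>
  from G(1) F have "dig_homotopy X \<kappa> Y \<mu> f g m G"
    unfolding dig_homotopy_def real_dig_homotopy_def by simp
  with G(2) show ?thesis by blast
qed

section \<open>Transfer to homotopy relations and homotopy types\<close>

lemma dig_homotopic_imp_real_dig_homotopic:
  "dig_homotopic X \<kappa> Y \<mu> f g \<Longrightarrow> real_dig_homotopic X \<kappa> Y \<mu> f g"
  unfolding dig_homotopic_def real_dig_homotopic_def
  using dig_homotopy_imp_real_dig_homotopy by blast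

lemma real_dig_homotopic_imp_dig_homotopic:
  assumes "real_dig_homotopic X \<kappa> Y \<mu> f g" "symp_on Y \<mu>" "finite X"
  shows "dig_homotopic X \<kappa> Y \<mu> f g"
  using assms real_dig_homotopy_imp_dig_homotopy[where A = "{}"]
  unfolding dig_homotopic_def real_dig_homotopic_def by (metis empty_iff empty_subsetI)

lemma real_dig_homotopic_const_at_imp_dig_homotopic_fixing:
  assumes "real_dig_homotopic_const_at x0 y0 X \<kappa> Y \<mu> f g" "x0 \<in> X" "symp_on Y \<mu>" "finite X"
  shows "dig_homotopic_fixing x0 X \<kappa> Y \<mu> f g"
proof -
  from assms(1) obtain F where F: "real_dig_homotopy X \<kappa> Y \<mu> f g F" "\<forall>t\<in>{0..1}. F x0 t = y0"
    unfolding real_dig_homotopic_const_at_def by blast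
  have "\<exists>m G. dig_homotopy X \<kappa> Y \<mu> f g m G \<and> (\<forall>x\<in>{x0}. \<forall>t\<in>{0..m}. G x t = G x 0)"
    using F assms by (intro real_dig_homotopy_imp_dig_homotopy[OF F(1)]) auto
  then show ?thesis unfolding dig_homotopic_fixing_def by simp
qed

theorem corollary5p11:
  fixes X :: "(int ^ 'n) set" and \<kappa> :: "int ^ 'n \<Rightarrow> int ^ 'n \<Rightarrow> bool"
    and Y :: "(int ^ 'm) set" and \<mu> :: "int ^ 'm \<Rightarrow> int ^ 'm \<Rightarrow> bool"
  assumes "digital_image X \<kappa>" and "digital_image Y \<mu>"
  shows "(same_homotopy_type X \<kappa> Y \<mu> \<longrightarrow> same_real_homotopy_type X \<kappa> Y \<mu>) \<and>
    (\<forall>x0\<in>X. \<forall>y0\<in>Y. same_pointed_homotopy_type X \<kappa> x0 Y \<mu> y0 \<longrightarrow>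
        same_pointed_real_homotopy_type X \<kappa> x0 Y \<mu> y0) \<and>
    (finite X \<and> finite Y \<longrightarrow>
       (same_real_homotopy_type X \<kappa> Y \<mu> \<longrightarrow> same_homotopy_type X \<kappa> Y \<mu>) \<and>
       (\<forall>x0\<in>X. \<forall>y0\<in>Y. same_pointed_real_homotopy_type X \<kappa> x0 Y \<mu> y0 \<longrightarrow>
          same_pointed_homotopy_type X \<kappa> x0 Y \<mu> y0))"
proof (intro conjI impI ballI)
  have X: "symp_on X \<kappa>" and Y: "symp_on Y \<mu>"
    using assms by (auto simp: digital_image_def)
  show "same_real_homotopy_type X \<kappa> Y \<mu>" if "same_homotopy_type X \<kappa> Y \<mu>"
    using that dig_homotopic_imp_real_dig_homotopic
    unfolding same_homotopy_type_def same_real_homotopy_type_def by metis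
  \<comment> \<open>The same maps serve for both types. The constant value obtained at
    \<open>x0\<close> is \<open>(g \<circ> f) x0\<close>, which is \<open>g y0 = x0\<close>;
    likewise at \<open>y0\<close>.\<close>
  show "same_pointed_real_homotopy_type X \<kappa> x0 Y \<mu> y0"
    if "x0 \<in> X" "y0 \<in> Y" "same_pointed_homotopy_type X \<kappa> x0 Y \<mu> y0" for x0 y0
    using that dig_homotopic_fixing_imp_real_dig_homotopic_const_at
    unfolding same_pointed_homotopy_type_def same_pointed_real_homotopy_type_def
    by (metis comp_apply)
  show "same_homotopy_type X \<kappa> Y \<mu>"
    if "finite X \<and> finite Y" "same_real_homotopy_type X \<kappa> Y \<mu>"
    using that X Y real_dig_homotopic_imp_dig_homotopic
    unfolding same_homotopy_type_def same_real_homotopy_type_def by metis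
  show "same_pointed_homotopy_type X \<kappa> x0 Y \<mu> y0"
    if "finite X \<and> finite Y" "x0 \<in> X" "y0 \<in> Y"
      "same_pointed_real_homotopy_type X \<kappa> x0 Y \<mu> y0" for x0 y0
    using that X Y real_dig_homotopic_const_at_imp_dig_homotopic_fixing
    unfolding same_pointed_homotopy_type_def same_pointed_real_homotopy_type_def by metis
qed

end
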